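(* Let $\mathcal G=(\mathcal V,\mathcal E)$ be a single-source acyclic, unit-delay, memory-free network with multicast min-cut $n$ and sink set $\mathcal T$, let $\Phi$ be an error pattern set, and let $1\le k<n$. Let $r$ and $T_{delay}$ be the quantities, defined in the context, associated with the $n$-dimensional multicast network code over $\mathbb F_q$ and the processing functions in use. If the field size $q$ is such that $$n\mid (q-1)\quad\text{and}\quad q>\max\left\{|\mathcal T|,\ \frac{2rn^2\left[(n+1)(T_{delay}-1)+1\right]}{n-k}+2\right\},$$ then a convolutional code $\mathcal C_s$ as required can be constructed over $\mathbb F_q$ and used to multicast $k$ symbols to the set of sinks $\mathcal T$ along with the required error correction. That is: an $n$-dimensional multicast network code over $\mathbb F_q$ exists when $q>|\mathcal T|$, and for such a network code with associated $r$, $T_{delay}$ satisfying the displayed conditions there exists a rate $k/n$ convolutional code $\mathcal C_s$ over $\mathbb F_q$ with $d_{free}(\mathcal C_s)\ge 2t_s+1$.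
   Context: **Network.** $\mathcal G=(\mathcal V,\mathcal E)$ is a finite acyclic directed multigraph with source $s$ and set of sinks $\mathcal T$; each edge carries one symbol of $\mathbb F_q$ per time instant and has unit delay, represented by $z$. Internal nodes are memory-free: they send $\mathbb F_q$-linear combinations of the symbols received at the current instant. $n$ is the minimum over $T\in\mathcal T$ of the maximum number of edge-disjoint $s$–$T$ paths. Edges $e_1,\dots,e_{|\mathcal E|}$ are in ancestral order; $\Gamma_O(v)$ and $\Gamma_I(v)$ are the outgoing and incoming edges of $v$; $head(e)=v$ if $e\in\Gamma_I(v)$ and $tail(e)=v$ if $e\in\Gamma_O(v)$. **Network code.** An $n$-dimensional (multicast) network code consists of matrices over $\mathbb F_q$: $A$ ($n\times|\mathcal E|$, with $A_{i,j}=0$ unless $e_j\in\Gamma_O(s)$); $K$ ($|\mathcal E|\times|\mathcal E|$, with $K_{i,j}=0$ unless $head(e_i)=tail(e_j)$); and for each sink $T$ a matrix $B^{T}$ ($|\mathcal E|\times n$; the superscript denotes the sink) with $B^{T}_{i,j}=0$ unless $e_i\in\Gamma_I(T)$. Put $F(z)=(I-zK)^{-1}$ (a polynomial matrix), $F_T(z)=F(z)B^{T}$, $M_T(z)=AF_T(z)$; it is required that the $n\times n$ matrix $M_T(z)$ has full rank over $\mathbb F_q(z)$ for every $T\in\mathcal T$. **Errors and processing.** An error pattern is a subset of $\mathcal E$; an error pattern set $\Phi$ is a collection of error patterns. $\mathcal W_\Phi$ is the set of $\boldsymbol w\in\mathbb F_q^{|\mathcal E|}$ whose nonzero coordinates all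 lie on edges of some $\rho\in\Phi$. For each sink $T$ the processing function $p_T(z)\in\mathbb F_q[z]$ is a nonzero polynomial such that $P_T(z):=p_T(z)M_T^{-1}(z)$ is a polynomial matrix. $w_H$ is Hamming weight over $\mathbb F_q$: for (vectors of) polynomials or power series, the total number of nonzero $\mathbb F_q$-coefficients. Put $\mathcal W_s=\bigcup_{T\in\mathcal T}\{\boldsymbol wF_T(z)P_T(z):\boldsymbol w\in\mathcal W_\Phi\}$, $t_s=\max_{\boldsymbol w_s(z)\in\mathcal W_s}w_H(\boldsymbol w_s(z))$, $r=\max_{T\in\mathcal T}w_H(p_T(z))$, and let $T_{delay}-1$ be the maximum degree of any entry of $F(z)$. **Convolutional codes.** A rate $k/n$ convolutional code with $k\times n$ generator matrix $G(z)$ over $\mathbb F_q(z)$ of rank $k$ is $\mathcal C=\{\boldsymbol u(z)G(z)\in\mathbb F_q^n[[z]]:\boldsymbol u(z)\in\mathbb F_q^k[[z]]\}$; $d_{free}(\mathcal C)$ is the minimum Hamming weight of its nonzero codewords. The required error correction is expressed by the free distance condition $d_{free}(\mathcal C_s)\ge 2t_s+1$ on the code $\mathcal C_s$ used at the source. *)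

theory Defs
  imports
    "Graph_Theory.Arc_Walk"
    "Jordan_Normal_Form.DL_Rank"
    "Jordan_Normal_Form.Determinant"
    "HOL-Computational_Algebra.Polynomial_Factorial"
    "HOL-Computational_Algebra.Formal_Laurent_Series"
    "HOL-Library.Extended_Nat"
    "HOL-Library.Cardinality"
begin

section \<open>Networks\<close>

text \<open>
  Edges are arcs of a multigraph in the sense of \<^locale>\<open>fin_digraph\<close> (parallel arcs allowed).
  The list \<open>es\<close> enumerates the edges in ancestral order; row or column \<open>i\<close> of the matrices
  below belongs to the edge \<open>es ! i\<close> (indices start at 0).
\<close>

locale multicast_network = fin_digraph G
  for G :: "('v, 'e) pre_digraph" +
  fixes s :: 'v and Ts :: "'v set" and es :: "'e list"
  assumes acyclic: "acyclic (arcs_ends G)"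
    and source: "s \<in> verts G"
    and sinks: "Ts \<subseteq> verts G" "Ts \<noteq> {}"
    and edge_list: "set es = arcs G" "distinct es"
    and ancestral:
      "\<lbrakk>i < length es; j < length es; head G (es ! i) = tail G (es ! j)\<rbrakk> \<Longrightarrow> i < j"

definition max_edge_disjoint_paths :: "('v, 'e) pre_digraph \<Rightarrow> 'v \<Rightarrow> 'v \<Rightarrow> nat" where
  "max_edge_disjoint_paths G s t =
     Max {card P |P. (\<forall>\<pi>\<in>P. pre_digraph.apath G s \<pi> t) \<and>
                     pairwise (\<lambda>\<pi> \<pi>'. set \<pi> \<inter> set \<pi>' = {}) P}"

definition multicast_min_cut :: "('v, 'e) pre_digraph \<Rightarrow> 'v \<Rightarrow> 'v set \<Rightarrow> nat" where
  "multicast_min_cut G s Ts = Min (max_edge_disjoint_paths G s ` Ts)"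

section \<open>Network codes\<close>

definition mat_inv :: "'a::comm_ring_1 mat \<Rightarrow> 'a mat" where
  "mat_inv X = (THE Y. Y \<in> carrier_mat (dim_row X) (dim_row X) \<and>
                       inverts_mat X Y \<and> inverts_mat Y X)"

lemma mat_inv_eqI:
  assumes "X \<in> carrier_mat m m" "Y \<in> carrier_mat m m" "X * Y = 1\<^sub>m m" "Y * X = 1\<^sub>m m"
  shows "mat_inv X = Y"
  unfolding mat_inv_def
proof (rule the_equality)
  show "Y \<in> carrier_mat (dim_row X) (dim_row X) \<and> inverts_mat X Y \<and> inverts_mat Y X"
    using assms by (auto simp: inverts_mat_def)
next
  fix Z
  assume Z: "Z \<in> carrier_mat (dim_row X) (dim_row X) \<and> inverts_mat X Z \<and> inverts_mat Z X"
  then have Z': "Z \<in> carrier_mat m m" "Z * X = 1\<^sub>m m"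
    using assms(1) by (auto simp: inverts_mat_def)
  have "Z = Z * (X * Y)" using Z'(1) assms(3) by simp
  also have "\<dots> = (Z * X) * Y" using Z'(1) assms(1,2) by (simp add: assoc_mult_mat)
  also have "\<dots> = Y" using Z'(2) assms(2) by simp
  finally show "Z = Y" .
qed

abbreviation const_mat :: "'f::zero mat \<Rightarrow> 'f poly mat" where
  "const_mat \<equiv> map_mat (\<lambda>c. [:c:])"

definition F_mat :: "'f::field mat \<Rightarrow> 'f poly mat" where
  "F_mat K = mat_inv (1\<^sub>m (dim_row K) - [:0, 1:] \<cdot>\<^sub>m const_mat K)"

text \<open>
  In an ancestral order the matrix \<open>K\<close> is strictly upper triangular, so the inverse defining
  \<open>F_mat\<close> does exist over the polynomials.
\<close>

lemma F_mat_correct: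
  fixes K :: "'f::field mat"
  assumes K: "K \<in> carrier_mat m m"
    and strict: "\<And>i j. i < m \<Longrightarrow> j < m \<Longrightarrow> K $$ (i, j) \<noteq> 0 \<Longrightarrow> i < j"
  defines "X \<equiv> 1\<^sub>m m - [:0, 1:] \<cdot>\<^sub>m const_mat K"
  shows "F_mat K \<in> carrier_mat m m" "X * F_mat K = 1\<^sub>m m" "F_mat K * X = 1\<^sub>m m"
proof -
  have X: "X \<in> carrier_mat m m" using K by (simp add: X_def minus_carrier_mat)
  have ent: "X $$ (i, j) = (if i = j then 1 else 0) - [:0, K $$ (i, j):]"
    if "i < m" "j < m" for i j
    using that K by (simp add: X_def)
  have ut: "upper_triangular X"
    unfolding upper_triangular_def
  proof (intro allI impI)
    fix i j assume "i < dim_row X" "j < i"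
    then show "X $$ (i, j) = 0" using ent[of i j] strict[of i j] X by fastforce
  qed
  have "diag_mat X = replicate m 1"
  proof (rule nth_equalityI)
    show "length (diag_mat X) = length (replicate m 1)" using X by (simp add: diag_mat_def)
    fix i assume "i < length (diag_mat X)"
    then have "i < m" using X by (simp add: diag_mat_def)
    moreover from this have "K $$ (i, i) = 0" using strict[of i i] by blast
    ultimately show "diag_mat X ! i = replicate m 1 ! i"
      using ent[of i i] X by (simp add: diag_mat_def)
  qed
  then have "det X = 1" using det_upper_triangular[OF ut X] by simp
  then have adj: "X * adj_mat X = 1\<^sub>m m" "adj_mat X * X = 1\<^sub>m m" "adj_mat X \<in> carrier_mat m m"
    using adj_mat[OF X] by (auto intro!: eq_matI)
  have "F_mat K = adj_mat X"
    unfolding F_mat_def using mat_inv_eqI[OF X adj(3,1,2)] K by (simp add: X_def)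
  then show "F_mat K \<in> carrier_mat m m" "X * F_mat K = 1\<^sub>m m" "F_mat K * X = 1\<^sub>m m"
    using adj by simp_all
qed

definition FT_mat :: "'f::field mat \<Rightarrow> 'f mat \<Rightarrow> 'f poly mat" where
  "FT_mat K BT = F_mat K * const_mat BT"

definition MT_mat :: "'f::field mat \<Rightarrow> 'f mat \<Rightarrow> 'f mat \<Rightarrow> 'f poly mat" where
  "MT_mat A K BT = const_mat A * FT_mat K BT"

definition network_code ::
  "('v, 'e) pre_digraph \<Rightarrow> 'v \<Rightarrow> 'v set \<Rightarrow> 'e list \<Rightarrow> nat \<Rightarrow>
   'f::field mat \<Rightarrow> 'f mat \<Rightarrow> ('v \<Rightarrow> 'f mat) \<Rightarrow> bool" where
  "network_code G s Ts es n A K B \<longleftrightarrow>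
     (let m = length es in
        A \<in> carrier_mat n m \<and>
        (\<forall>i<n. \<forall>j<m. es ! j \<notin> out_arcs G s \<longrightarrow> A $$ (i, j) = 0) \<and>
        K \<in> carrier_mat m m \<and>
        (\<forall>i<m. \<forall>j<m. head G (es ! i) \<noteq> tail G (es ! j) \<longrightarrow> K $$ (i, j) = 0) \<and>
        (\<forall>T\<in>Ts. B T \<in> carrier_mat m n \<and>
           (\<forall>i<m. \<forall>j<n. es ! i \<notin> in_arcs G T \<longrightarrow> B T $$ (i, j) = 0) \<and>
           vec_space.rank n (map_mat to_fract (MT_mat A K (B T))) = n))"

definition T_delay :: "'f::field mat \<Rightarrow> nat" where
  "T_delay K = Max (degree ` elements_mat (F_mat K)) + 1"

section \<open>Errors and processing\<close>

text \<open>
  \<open>PT_rel A K BT p P\<close>: the polynomial matrix \<open>P\<close> equals \<open>p \<cdot> M\<^sub>T\<inverse>\<close>, the inverse being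
  taken over the field of rational functions. Such a \<open>P\<close> is unique if it exists.
\<close>

definition PT_rel ::
  "'f::field mat \<Rightarrow> 'f mat \<Rightarrow> 'f mat \<Rightarrow> 'f poly \<Rightarrow> 'f poly mat \<Rightarrow> bool" where
  "PT_rel A K BT p P \<longleftrightarrow>
     map_mat to_fract P = to_fract p \<cdot>\<^sub>m mat_inv (map_mat to_fract (MT_mat A K BT))"

definition processing_function ::
  "'f::field mat \<Rightarrow> 'f mat \<Rightarrow> 'f mat \<Rightarrow> 'f poly \<Rightarrow> bool" where
  "processing_function A K BT p \<longleftrightarrow> p \<noteq> 0 \<and> (\<exists>P. PT_rel A K BT p P)"

definition PT_mat :: "'f::field mat \<Rightarrow> 'f mat \<Rightarrow> 'f mat \<Rightarrow> 'f poly \<Rightarrow> 'f poly mat" where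
  "PT_mat A K BT p = (THE P. PT_rel A K BT p P)"

definition poly_weight :: "'f::zero poly \<Rightarrow> nat" where
  "poly_weight p = card {i. coeff p i \<noteq> 0}"

definition poly_vec_weight :: "'f::zero poly vec \<Rightarrow> nat" where
  "poly_vec_weight v = (\<Sum>i<dim_vec v. poly_weight (v $ i))"

definition error_vectors :: "'e list \<Rightarrow> 'e set set \<Rightarrow> 'f::zero vec set" where
  "error_vectors es \<Phi> =
     {w \<in> carrier_vec (length es). \<exists>\<rho>\<in>\<Phi>. \<forall>i<length es. w $ i \<noteq> 0 \<longrightarrow> es ! i \<in> \<rho>}"

text \<open>The row vector times matrix product \<open>v X\<close>.\<close>

definition row_mult :: "'a::comm_semiring_0 vec \<Rightarrow> 'a mat \<Rightarrow> 'a vec" where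
  "row_mult v X = transpose_mat X *\<^sub>v v"

definition W_s ::
  "'v set \<Rightarrow> 'e list \<Rightarrow> 'e set set \<Rightarrow>
   'f::field mat \<Rightarrow> 'f mat \<Rightarrow> ('v \<Rightarrow> 'f mat) \<Rightarrow> ('v \<Rightarrow> 'f poly) \<Rightarrow> 'f poly vec set" where
  "W_s Ts es \<Phi> A K B p =
     (\<Union>T\<in>Ts. {row_mult (map_vec (\<lambda>c. [:c:]) w) (FT_mat K (B T) * PT_mat A K (B T) (p T)) |w.
                 w \<in> error_vectors es \<Phi>})"

text \<open>
  As soon as \<open>\<Phi>\<close> is nonempty, the zero vector belongs to \<open>W_s\<close>; inserting 0 only fixes the
  value 0 for \<open>\<Phi> = {}\<close>.
\<close>

definition t_s ::
  "'v set \<Rightarrow> 'e list \<Rightarrow> 'e set set \<Rightarrow>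
   'f::field mat \<Rightarrow> 'f mat \<Rightarrow> ('v \<Rightarrow> 'f mat) \<Rightarrow> ('v \<Rightarrow> 'f poly) \<Rightarrow> nat" where
  "t_s Ts es \<Phi> A K B p = Max (insert 0 (poly_vec_weight ` W_s Ts es \<Phi> A K B p))"

definition max_processing_weight :: "'v set \<Rightarrow> ('v \<Rightarrow> 'f::zero poly) \<Rightarrow> nat" where
  "max_processing_weight Ts p = Max ((\<lambda>T. poly_weight (p T)) ` Ts)"

section \<open>Convolutional codes\<close>

text \<open>The embedding of the rational functions into the formal Laurent series.\<close>

definition fract_to_fls :: "'f::field poly fract \<Rightarrow> 'f fls" where
  "fract_to_fls x = (THE y. \<exists>a b. b \<noteq> 0 \<and> x = Fract a b \<and>
     y = fps_to_fls (fps_of_poly a) / fps_to_fls (fps_of_poly b))"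

lemma fract_to_fls_Fract:
  assumes b: "b \<noteq> 0"
  shows "fract_to_fls (Fract a b) = fps_to_fls (fps_of_poly a) / fps_to_fls (fps_of_poly b)"
  unfolding fract_to_fls_def
proof (rule the_equality)
  show "\<exists>a' b'. b' \<noteq> 0 \<and> Fract a b = Fract a' b' \<and>
      fps_to_fls (fps_of_poly a) / fps_to_fls (fps_of_poly b) =
      fps_to_fls (fps_of_poly a') / fps_to_fls (fps_of_poly b')"
    using b by blast
next
  fix y
  assume "\<exists>a' b'. b' \<noteq> 0 \<and> Fract a b = Fract a' b' \<and>
      y = fps_to_fls (fps_of_poly a') / fps_to_fls (fps_of_poly b')"
  then obtain a' b' where b': "b' \<noteq> 0" and eq: "Fract a b = Fract a' b'"
    and y: "y = fps_to_fls (fps_of_poly a') / fps_to_fls (fps_of_poly b')" by blast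
  have "a * b' = a' * b" using eq b b' by (simp add: eq_fract)
  then have "fps_to_fls (fps_of_poly a) * fps_to_fls (fps_of_poly b') =
             fps_to_fls (fps_of_poly a') * fps_to_fls (fps_of_poly b)"
    by (metis fls_times_fps_to_fls fps_of_poly_mult)
  then show "y = fps_to_fls (fps_of_poly a) / fps_to_fls (fps_of_poly b)"
    using b b' by (simp add: y frac_eq_eq)
qed

definition conv_code_of :: "nat \<Rightarrow> nat \<Rightarrow> 'f::field poly fract mat \<Rightarrow> 'f fps vec set" where
  "conv_code_of k n G =
     {c \<in> carrier_vec n. \<exists>u \<in> carrier_vec k.
        map_vec fps_to_fls c = row_mult (map_vec fps_to_fls u) (map_mat fract_to_fls G)}"

definition convolutional_code :: "nat \<Rightarrow> nat \<Rightarrow> 'f::field fps vec set \<Rightarrow> bool" where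
  "convolutional_code k n C \<longleftrightarrow>
     (\<exists>G \<in> carrier_mat k n. vec_space.rank k G = k \<and> C = conv_code_of k n G)"

definition fps_weight :: "'f::zero fps \<Rightarrow> enat" where
  "fps_weight f = (if finite {i. fps_nth f i \<noteq> 0} then enat (card {i. fps_nth f i \<noteq> 0}) else \<infinity>)"

definition fps_vec_weight :: "'f::zero fps vec \<Rightarrow> enat" where
  "fps_vec_weight v = (\<Sum>i<dim_vec v. fps_weight (v $ i))"

definition d_free :: "nat \<Rightarrow> 'f::zero fps vec set \<Rightarrow> enat" where
  "d_free n C = (INF c \<in> C - {0\<^sub>v n}. fps_vec_weight c)"

end

theory Submission
  imports Defs
begin

text \<open>
  Network code: By a Schur complement, \<open>det M\<^sub>T\<close> vanishes iff the determinant of the bordered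
  matrix with rows \<open>(I - zK, B\<^sup>T)\<close> and \<open>(-A, 0)\<close> does, and the latter is affine in each single
  entry of \<open>A\<close> and \<open>K\<close>. For each sink separately, routing along edge-disjoint paths makes it
  nonzero. Choosing the entries one after the other, every sink excludes at most one value, so
  more than \<open>card Ts\<close> field elements suffice.

  Convolutional code: take \<open>k\<close> independent words orthogonal to polynomials \<open>h\<^sub>0, \<dots>, h\<^sub>n\<^sub>-\<^sub>1\<close>
  with \<open>D\<close> terms each whose exponents form a Golomb ruler. One nonzero coefficient of a codeword
  spreads to \<open>D\<close> coefficients of the vanishing syndrome, and every other one can cancel at most
  one of these; hence the free distance exceeds \<open>D\<close>.
\<close>

section \<open>Convolutional codes of arbitrarily large free distance\<close>

no_notation fps_nth (infixl "$" 75)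

text \<open>If \<open>x < u\<close>, then 3^(x+1) divides the right-hand side, while the left-hand
  side is 3^x times 1 + 3^(y-x), which is never divisible by 3. Base 2 would fail here for
  \<open>y = x\<close>.\<close>

lemma power3_sum_eq_imp_min_eq:
  assumes "(3::nat)^x + 3^y = 3^u + 3^v" "x \<le> y" "u \<le> v"
  shows "x = u \<and> y = v"
proof -
  have *: False if "x < u" "x \<le> y" "u \<le> v" "(3::nat)^x + 3^y = 3^u + 3^v" for x y u v :: nat
  proof -
    have "(3::nat)^Suc x dvd 3^u + 3^v"
      using that by (intro dvd_add le_imp_power_dvd) auto
    then have "(3::nat)^x * 3 dvd 3^x * (1 + 3^(y - x))"
      using that by (simp add: algebra_simps flip: power_add)
    then have *: "3 dvd (1::nat) + 3^(y - x)"
      using nat_mult_dvd_cancel_disj by (metis power_not_zero zero_neq_numeral)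
    show False
    proof (cases "y - x")
      case 0
      with * show ?thesis by (simp add: numeral_2_eq_2[symmetric])
    next
      case (Suc l)
      then have "(3::nat) dvd 3^(y - x)" by simp
      with * show ?thesis using dvd_add_left_iff[of 3 "3^(y - x)" "1::nat"] by simp
    qed
  qed
  have "x = u" using *[of x u y v] *[of u x v y] assms by (metis linorder_neqE_nat)
  then show ?thesis using assms(1) by simp
qed

text \<open>Sorting both sides reduces this to the ordered case. It says that the powers of 3 form a
  Sidon set, equivalently a Golomb ruler.\<close>

lemma power3_sum_eq:
  assumes "(3::nat)^x + 3^y = 3^u + 3^v"
  shows "x = u \<and> y = v \<or> x = v \<and> y = u"
  using power3_sum_eq_imp_min_eq[of x y u v] power3_sum_eq_imp_min_eq[of y x u v]
    power3_sum_eq_imp_min_eq[of x y v u] power3_sum_eq_imp_min_eq[of y x v u] assms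
  by (metis add.commute nat_le_linear)

text \<open>
  All differences of distinct exponents in \<open>ruler_poly n D 0, \<dots>, ruler_poly n D (n - 1)\<close> are
  distinct (a Golomb ruler), so two different nonzero coefficients of a word contribute to at most
  one common coefficient of its syndrome.
\<close>

definition ruler_poly :: "nat \<Rightarrow> nat \<Rightarrow> nat \<Rightarrow> 'f::field poly" where
  "ruler_poly n D i = (\<Sum>j<D. monom 1 (3 ^ (j * n + i)))"

lemma coeff_ruler_poly:
  assumes "j < D" "0 < n"
  shows "coeff (ruler_poly n D i) (3 ^ (j * n + i)) = (1::'f::field)"
proof -
  have "coeff (ruler_poly n D i) (3 ^ (j * n + i)) = (\<Sum>l<D. if l = j then 1 else (0::'f))"
    unfolding ruler_poly_def coeff_sum by (intro sum.cong) (use assms in auto)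
  then show ?thesis using assms by simp
qed

lemma ruler_poly_nonzero: "0 < D \<Longrightarrow> 0 < n \<Longrightarrow> ruler_poly n D i \<noteq> (0::'f::field poly)"
  using coeff_ruler_poly[of 0 D n i, where 'f='f] by auto

lemma nth_mult_ruler_poly:
  fixes f :: "'f::field fps"
  shows "fps_nth (f * fps_of_poly (ruler_poly n D i)) N =
    (\<Sum>j<D. if N < 3 ^ (j * n + i) then 0 else fps_nth f (N - 3 ^ (j * n + i)))"
  by (simp add: ruler_poly_def fps_of_poly_sum fps_of_poly_monom sum_distrib_left fps_sum_nth
      fps_X_power_mult_right_nth)

text \<open>Prepares the counting: an infinite coordinate support would make the sum infinite, so a
  finite weight is the size of one finite set of pairs (coordinate, power of z).\<close>

lemma fps_vec_weight_eq_card: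
  assumes "fps_vec_weight c = enat w"
  shows "finite {(i, a). i < dim_vec c \<and> fps_nth (c $ i) a \<noteq> 0}"
    and "card {(i, a). i < dim_vec c \<and> fps_nth (c $ i) a \<noteq> 0} = w"
proof -
  have fin: "finite {a. fps_nth (c $ i) a \<noteq> 0}" if "i < dim_vec c" for i
  proof (rule ccontr)
    assume "infinite {a. fps_nth (c $ i) a \<noteq> 0}"
    then have "fps_weight (c $ i) = \<infinity>" by (simp add: fps_weight_def)
    then have "fps_vec_weight c = \<infinity>"
      using that unfolding fps_vec_weight_def by (subst sum.remove[of _ i]) auto
    with assms show False by simp
  qed
  have eq: "{(i, a). i < dim_vec c \<and> fps_nth (c $ i) a \<noteq> 0} =
      (SIGMA i:{..<dim_vec c}. {a. fps_nth (c $ i) a \<noteq> 0})" by auto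
  show "finite {(i, a). i < dim_vec c \<and> fps_nth (c $ i) a \<noteq> 0}"
    unfolding eq using fin by auto
  have "enat w = (\<Sum>i<dim_vec c. enat (card {a. fps_nth (c $ i) a \<noteq> 0}))"
    unfolding assms[symmetric] fps_vec_weight_def
    by (intro sum.cong) (use fin in \<open>auto simp: fps_weight_def\<close>)
  also have "\<dots> = enat (\<Sum>i<dim_vec c. card {a. fps_nth (c $ i) a \<noteq> 0})"
    using of_nat_sum[where 'a=enat, of "\<lambda>i. card {a. fps_nth (c $ i) a \<noteq> 0}" "{..<dim_vec c}"]
    by (simp add: of_nat_eq_enat)
  finally show "card {(i, a). i < dim_vec c \<and> fps_nth (c $ i) a \<noteq> 0} = w"
    unfolding eq by (subst card_SigmaI) (use fin in auto)
qed

text \<open>Suppose the weight is at most D and fix a nonzero coefficient at (i, a). It reaches D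
  positions of the syndrome, and each of the at most D - 1 others meets at most one of them. At some
  position it therefore stands alone, and the syndrome is nonzero.\<close>

lemma self_orthogonal_weight:
  fixes c :: "'f::field fps vec"
  assumes c: "c \<in> carrier_vec n" "c \<noteq> 0\<^sub>v n"
    and check: "(\<Sum>i<n. (c $ i) * fps_of_poly (ruler_poly n D i)) = 0"
  shows "enat D < fps_vec_weight c"
proof (rule ccontr)
  assume "\<not> ?thesis"
  then obtain w where w: "fps_vec_weight c = enat w" "w \<le> D"
    by (cases "fps_vec_weight c") auto
  define S where "S = {(i, a). i < n \<and> fps_nth (c $ i) a \<noteq> 0}"
  have S: "finite S" "card S \<le> D"
    using fps_vec_weight_eq_card[OF w(1)] w(2) c(1) by (auto simp: S_def)
  obtain i a where ia: "i < n" "fps_nth (c $ i) a \<noteq> 0"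
    using c by (metis carrier_vecD eq_vecI fps_eq_iff fps_zero_nth index_zero_vec)
  define e where "e i j = (3::nat) ^ (j * n + i)" for i j
  \<comment> \<open>The exponent encodes the pair (j, i) in base n; \<open>i < n\<close> makes it
    decodable.\<close>
  have idx: "j = j' \<and> i = i'" if "j * n + i = j' * n + i'" "i < n" "i' < n" for i i' j j'
    using that by (metis add.commute add_left_imp_eq div_mult_self3 div_less nat_neq_iff
        mod_less mod_mult_self3 not_less0 add_0 div_mult_self4 mult.commute)
  \<comment> \<open>Pigeonhole: otherwise a choice \<open>\<phi>\<close> of colliding support points
    would inject D indices into at most D - 1 points.\<close>
  have "\<exists>j<D. \<forall>(i', a')\<in>S - {(i, a)}. \<forall>j'<D. a' + e i' j' \<noteq> a + e i j"
  proof (rule ccontr)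
    assume "\<not> ?thesis"
    then have "\<forall>j\<in>{..<D}. \<exists>x. x \<in> S - {(i, a)} \<and> (\<exists>j'<D. snd x + e (fst x) j' = a + e i j)"
      by fastforce
    then obtain \<phi> where \<phi>: "\<And>j. j < D \<Longrightarrow> \<phi> j \<in> S - {(i, a)}"
      "\<And>j. j < D \<Longrightarrow> \<exists>j'<D. snd (\<phi> j) + e (fst (\<phi> j)) j' = a + e i j"
      by (metis lessThan_iff)
    have "inj_on \<phi> {..<D}"
    proof (rule inj_onI)
      fix j k assume jk: "j \<in> {..<D}" "k \<in> {..<D}" "\<phi> j = \<phi> k"
      obtain i' a' where x: "\<phi> j = (i', a')" by fastforce
      have x': "i' < n" "(i', a') \<noteq> (i, a)" using \<phi>(1)[of j] jk x by (auto simp: S_def)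
      obtain j' k' where "a' + e i' j' = a + e i j" "a' + e i' k' = a + e i k"
        using \<phi>(2)[of j] \<phi>(2)[of k] jk(1,2) x x[unfolded jk(3)] by auto
      \<comment> \<open>Combining the two collisions crosswise cancels \<open>a\<close> and
        \<open>a'\<close> and leaves equal sums of two powers of 3. One matching makes the colliding
        point (i, a) itself, the other gives \<open>j = k\<close>.\<close>
      then have eqs: "e i' j' + e i k = e i j + e i' k'" "a' + e i' j' = a + e i j" by simp_all
      from power3_sum_eq[OF eqs(1)[unfolded e_def]] show "j = k"
      proof
        assume "j' * n + i' = j * n + i \<and> k * n + i = k' * n + i'"
        then have "i' = i \<and> j' = j" using idx[of j' i' j i] x' ia by blast
        then show ?thesis using eqs(2) x' by simp
      next
        assume "j' * n + i' = k' * n + i' \<and> k * n + i = j * n + i"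
        then show ?thesis using idx[of k i j i] ia by blast
      qed
    qed
    moreover have "\<phi> ` {..<D} \<subseteq> S - {(i, a)}" by (intro image_subsetI \<phi>(1)) simp
    ultimately have "D \<le> card (S - {(i, a)})"
      using S(1) card_inj_on_le[of \<phi> "{..<D}" "S - {(i, a)}"] by simp
    moreover have "(i, a) \<in> S" using ia by (simp add: S_def)
    ultimately show False
      using S by (metis card_Diff1_less leD le_trans)
  qed
  then obtain j where j: "j < D"
    "\<And>i' a' j'. (i', a') \<in> S \<Longrightarrow> j' < D \<Longrightarrow> a' + e i' j' = a + e i j \<Longrightarrow> (i', a') = (i, a)"
    by blast
  define N where "N = a + e i j"
  \<comment> \<open>In coefficient \<open>N\<close> of the syndrome only the term of (i, a) shifted
    by \<open>e i j\<close> survives.\<close>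
  have summand: "(if N < e i' j' then 0 else fps_nth (c $ i') (N - e i' j')) =
      (if i' = i then if j' = j then fps_nth (c $ i) a else 0 else 0)" if "i' < n" "j' < D" for i' j'
  proof (cases "N < e i' j' \<or> fps_nth (c $ i') (N - e i' j') = 0")
    case True
    then show ?thesis using ia by (auto simp: N_def)
  next
    case False
    then have "(i', N - e i' j') \<in> S" "N - e i' j' + e i' j' = N" using that by (auto simp: S_def)
    then have *: "i' = i" "N - e i' j' = a" using j(2)[of i' "N - e i' j'" j'] that by (auto simp: N_def)
    then have "e i j' = e i j" using False by (auto simp: N_def)
    then have "j' = j" using ia idx[of j' i j i] by (simp add: e_def)
    with * False show ?thesis by auto
  qed
  have "0 = fps_nth (\<Sum>i<n. (c $ i) * fps_of_poly (ruler_poly n D i)) N" using check by simp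
  also have "\<dots> = (\<Sum>i'<n. \<Sum>j'<D. if N < e i' j' then 0 else fps_nth (c $ i') (N - e i' j'))"
    unfolding e_def by (simp add: fps_sum_nth nth_mult_ruler_poly)
  also have "\<dots> = (\<Sum>i'<n. \<Sum>j'<D. if i' = i then if j' = j then fps_nth (c $ i) a else 0 else 0)"
    using summand by (intro sum.cong refl) auto
  also have "\<dots> = (\<Sum>i'<n. if i' = i then fps_nth (c $ i) a else 0)"
    using j(1) by (intro sum.cong refl) auto
  also have "\<dots> = fps_nth (c $ i) a" using ia by simp
  finally show False using ia by simp
qed

section \<open>Polynomial generator matrices, their codewords and their rank\<close>

lemma fract_to_fls_to_fract: "fract_to_fls (to_fract p) = fps_to_fls (fps_of_poly p)"
  using fract_to_fls_Fract[of 1 p] by (simp add: to_fract_def)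

lemma fps_to_fls_sum: "fps_to_fls (sum f A) = (\<Sum>x\<in>A. fps_to_fls (f x))"
  by (induction A rule: infinite_finite_induct) auto

text \<open>With polynomial entries no denominators occur, so the equation over Laurent series pulls
  back along the injective \<open>fps_to_fls\<close>.\<close>

lemma conv_code_of_polyD:
  fixes H :: "'f::field poly mat"
  assumes H: "H \<in> carrier_mat k n" and c: "c \<in> conv_code_of k n (map_mat to_fract H)"
  obtains u :: "'f fps vec" where "u \<in> carrier_vec k"
    "\<And>j. j < n \<Longrightarrow> c $ j = (\<Sum>i<k. u $ i * fps_of_poly (H $$ (i, j)))"
proof -
  obtain u where u: "u \<in> carrier_vec k" and cn: "c \<in> carrier_vec n"
    and eq: "map_vec fps_to_fls c =
      row_mult (map_vec fps_to_fls u) (map_mat fract_to_fls (map_mat to_fract H))"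
    using c unfolding conv_code_of_def by blast
  have "c $ j = (\<Sum>i<k. u $ i * fps_of_poly (H $$ (i, j)))" if j: "j < n" for j
  proof -
    have "fps_to_fls (c $ j) = map_vec fps_to_fls c $ j" using cn j by simp
    also have "\<dots> = (\<Sum>i<k. fps_to_fls (fps_of_poly (H $$ (i, j))) * fps_to_fls (u $ i))"
      unfolding eq row_mult_def using H u j
      by (simp add: scalar_prod_def fract_to_fls_to_fract lessThan_atLeast0)
    also have "\<dots> = fps_to_fls (\<Sum>i<k. u $ i * fps_of_poly (H $$ (i, j)))"
      by (simp add: fps_to_fls_sum fls_times_fps_to_fls mult.commute)
    finally show ?thesis by simp
  qed
  with u that show thesis by blast
qed

lemma (in vec_space) rank_le_nr:
  assumes "A \<in> carrier_mat n nc"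
  shows "rank A \<le> n"
proof -
  obtain S where S: "maximal S (\<lambda>T. T \<subseteq> set (cols A) \<and> lin_indpt T)"
    using maximal_exists[of "\<lambda>T. T \<subseteq> set (cols A) \<and> lin_indpt T" "card (set (cols A))" "{}"]
    by (meson List.finite_set card_mono empty_iff empty_subsetI finite_lin_indpt2 rev_finite_subset)
  then have "S \<subseteq> carrier_vec n" "lin_indpt S"
    using cols_dim[of A] assms unfolding maximal_def by auto
  then have "card S \<le> n" using li_le_dim(2)[OF fin_dim] by (simp add: dim_is_n)
  then show ?thesis using rank_card_indpt[OF assms S] by simp
qed

text \<open>The columns of the nonsingular leading block are n distinct independent columns of the
  whole matrix.\<close>

lemma (in vec_space) rank_eq_nr:
  assumes A: "A \<in> carrier_mat n nc" and "n \<le> nc"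
    and det: "det (mat n n (\<lambda>(i, j). A $$ (i, j))) \<noteq> 0"
  shows "rank A = n"
proof -
  define B where "B = mat n n (\<lambda>(i, j). A $$ (i, j))"
  have B: "B \<in> carrier_mat n n" by (simp add: B_def)
  have rk: "rank B = n" using det_rank_iff[OF B] det by (simp add: B_def)
  then have dist: "distinct (cols B)" using non_distinct_low_rank[OF B] by auto
  have "set (cols B) \<subseteq> set (cols A)"
  proof
    fix x assume "x \<in> set (cols B)"
    then obtain j where j: "j < n" "x = col B j" using B by (auto simp: cols_def)
    then have "x = col A j" using A \<open>n \<le> nc\<close> by (auto simp: B_def intro!: eq_vecI)
    then show "x \<in> set (cols A)" using A j \<open>n \<le> nc\<close> by (auto simp: cols_def)
  qed
  moreover have "card (set (cols B)) = n" using dist B by (simp add: distinct_card)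
  ultimately show ?thesis
    using rank_ge_card_indpt[OF A, of "set (cols B)"] full_rank_lin_indpt[OF B rk dist] rank_le_nr[OF A]
    by simp
qed

text \<open>With h_j for \<open>ruler_poly n D j\<close>, row i has h_(n-1) in column i and -h_i in
  the last column, so its products with the h_j cancel. For \<open>k < n\<close> the leading k x k
  block is h_(n-1) times the identity, which yields rank k.\<close>

definition self_orthogonal_mat :: "nat \<Rightarrow> nat \<Rightarrow> nat \<Rightarrow> 'f::field poly mat" where
  "self_orthogonal_mat k n D = mat k n (\<lambda>(i, j).
     if j = i then ruler_poly n D (n - 1) else if j = n - 1 then - ruler_poly n D i else 0)"

lemma self_orthogonal_mat_orthogonal:
  assumes "i < k" "k < n"
  shows "(\<Sum>j<n. self_orthogonal_mat k n D $$ (i, j) * ruler_poly n D j) = (0::'f::field poly)"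
proof -
  have "(\<Sum>j<n. self_orthogonal_mat k n D $$ (i, j) * ruler_poly n D j) =
    (\<Sum>j<n. (if j = i then ruler_poly n D (n - 1) * ruler_poly n D i else 0) +
      (if j = n - 1 then - ruler_poly n D i * ruler_poly n D (n - 1) else (0::'f poly)))"
    using assms by (intro sum.cong) (auto simp: self_orthogonal_mat_def)
  also have "\<dots> = 0" using assms by (simp add: sum.distrib)
  finally show ?thesis .
qed

text \<open>Codewords are power series combinations of rows orthogonal to the ruler polynomials,
  hence orthogonal to them as well; the number of ruler terms then bounds their weight from
  below.\<close>

theorem ex_convolutional_code_d_free_ge:
  assumes "k < n"
  shows "\<exists>C :: 'f::field fps vec set. convolutional_code k n C \<and> enat D \<le> d_free n C"
proof -
  \<comment> \<open>The extra term keeps the ruler polynomials nonzero when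
    \<open>D = 0\<close>.\<close>
  let ?D = "Suc D"
  define H :: "'f poly mat" where "H = self_orthogonal_mat k n ?D"
  have H: "H \<in> carrier_mat k n" by (simp add: H_def self_orthogonal_mat_def)
  define G where "G = map_mat to_fract H"
  have G: "G \<in> carrier_mat k n" using H by (simp add: G_def)
  have h: "ruler_poly n ?D (n - 1) \<noteq> (0::'f poly)" using ruler_poly_nonzero[of ?D n] assms by auto
  have "mat k k (\<lambda>(i, j). G $$ (i, j)) = to_fract (ruler_poly n ?D (n - 1)) \<cdot>\<^sub>m 1\<^sub>m k"
    by (rule eq_matI) (use assms in \<open>auto simp: G_def H_def self_orthogonal_mat_def\<close>)
  then have "det (mat k k (\<lambda>(i, j). G $$ (i, j))) \<noteq> 0" using h by simp
  then have "vec_space.rank k G = k" using vec_space.rank_eq_nr[OF G] assms by simp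
  then have "convolutional_code k n (conv_code_of k n G)" unfolding convolutional_code_def using G by blast
  moreover have "enat ?D \<le> fps_vec_weight c" if c: "c \<in> conv_code_of k n G - {0\<^sub>v n}" for c
  proof -
    have cn: "c \<in> carrier_vec n" "c \<noteq> 0\<^sub>v n" using c by (auto simp: conv_code_of_def)
    obtain u where u: "\<And>j. j < n \<Longrightarrow> c $ j = (\<Sum>i<k. u $ i * fps_of_poly (H $$ (i, j)))"
      using conv_code_of_polyD[OF H] c unfolding G_def by blast
    have "(\<Sum>j<n. c $ j * fps_of_poly (ruler_poly n ?D j)) =
        (\<Sum>j<n. \<Sum>i<k. u $ i * fps_of_poly (H $$ (i, j) * ruler_poly n ?D j))"
      by (intro sum.cong refl) (simp add: u sum_distrib_right fps_of_poly_mult mult.assoc)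
    also have "\<dots> = (\<Sum>i<k. u $ i * fps_of_poly (\<Sum>j<n. H $$ (i, j) * ruler_poly n ?D j))"
      by (subst sum.swap) (simp add: sum_distrib_left fps_of_poly_sum)
    also have "\<dots> = 0" using assms by (simp add: H_def self_orthogonal_mat_orthogonal)
    finally show ?thesis using self_orthogonal_weight[OF cn, of ?D] by simp
  qed
  then have "enat ?D \<le> d_free n (conv_code_of k n G)"
    unfolding d_free_def by (intro INF_greatest)
  then have "enat D \<le> d_free n (conv_code_of k n G)"
    by (rule order_trans[rotated]) simp
  ultimately show ?thesis by blast
qed

section \<open>Simultaneous nonvanishing of determinants\<close>

text \<open>
  A function that is affine in every variable and not identically zero after fixing some of the
  variables loses this property for at most one value of the next variable.
\<close>

lemma affine_family_common_nonzero:
  fixes f :: "'t \<Rightarrow> ('i \<Rightarrow> 'c::finite) \<Rightarrow> 'b::zero"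
  assumes "finite S" "finite Ts" "card Ts < CARD('c)"
    and "\<And>T x i c c1 c2. T \<in> Ts \<Longrightarrow> i \<in> S \<Longrightarrow> c1 \<noteq> c2 \<Longrightarrow>
      f T (x(i := c1)) = 0 \<Longrightarrow> f T (x(i := c2)) = 0 \<Longrightarrow> f T (x(i := c)) = 0"
    and "\<And>T. T \<in> Ts \<Longrightarrow> \<exists>x. (\<forall>i. i \<notin> S \<longrightarrow> x i = y i) \<and> f T x \<noteq> 0"
  shows "\<exists>x. (\<forall>i. i \<notin> S \<longrightarrow> x i = y i) \<and> (\<forall>T\<in>Ts. f T x \<noteq> 0)"
  using assms(1,4,5)
proof (induction S arbitrary: y rule: finite_induct)
  case empty
  have "f T y \<noteq> 0" if "T \<in> Ts" for T
  proof -
    obtain x where "\<forall>i. x i = y i" "f T x \<noteq> 0" using empty.prems(2)[OF \<open>T \<in> Ts\<close>] by auto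
    moreover from this have "x = y" by auto
    ultimately show ?thesis by simp
  qed
  then show ?case by auto
next
  case (insert i S)
  obtain X where X: "\<And>T j. T \<in> Ts \<Longrightarrow> j \<notin> insert i S \<Longrightarrow> X T j = y j"
    "\<And>T. T \<in> Ts \<Longrightarrow> f T (X T) \<noteq> 0"
    using insert.prems(2) by metis
  define bad where "bad T = {c. f T ((X T)(i := c)) = 0}" for T
  have card_bad: "card (bad T) \<le> 1" if "T \<in> Ts" for T
  proof -
    have "c1 = c2" if "c1 \<in> bad T" "c2 \<in> bad T" for c1 c2
    proof (rule ccontr)
      assume "c1 \<noteq> c2"
      \<comment> \<open>Two bad values would make every value of coordinate \<open>i\<close> bad,
        including the one that \<open>X T\<close> already has.\<close>
      then have "f T ((X T)(i := X T i)) = 0"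
        by (rule insert.prems(1)[OF \<open>T \<in> Ts\<close> insertI1]) (use that in \<open>simp_all add: bad_def fun_upd_def\<close>)
      then show False using X(2)[OF \<open>T \<in> Ts\<close>] by simp
    qed
    then show ?thesis by (simp add: card_le_Suc0_iff_eq)
  qed
  have "card (\<Union>T\<in>Ts. bad T) \<le> (\<Sum>T\<in>Ts. card (bad T))" by (rule card_UN_le[OF assms(2)])
  also have "\<dots> \<le> card Ts" using sum_mono[of Ts "\<lambda>T. card (bad T)" "\<lambda>_. 1"] card_bad by simp
  also have "\<dots> < CARD('c)" by (rule assms(3))
  finally obtain c where c: "c \<notin> (\<Union>T\<in>Ts. bad T)" by (metis UNIV_eq_I less_irrefl)
  \<comment> \<open>The value \<open>c\<close> joins the prescribed assignment, which is why the
    induction generalizes over \<open>y\<close>.\<close>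
  have "\<exists>x. (\<forall>j. j \<notin> S \<longrightarrow> x j = (y(i := c)) j) \<and> (\<forall>T\<in>Ts. f T x \<noteq> 0)"
  proof (rule insert.IH)
    show "f T (x(j := c)) = 0"
      if "T \<in> Ts" "j \<in> S" "c1 \<noteq> c2" "f T (x(j := c1)) = 0" "f T (x(j := c2)) = 0" for T x j c c1 c2
      using insert.prems(1)[OF that(1) insertI2[OF that(2)] that(3)] that(4,5) by (simp add: fun_upd_def)
    show "\<exists>x. (\<forall>j. j \<notin> S \<longrightarrow> x j = (y(i := c)) j) \<and> f T x \<noteq> 0" if "T \<in> Ts" for T
      by (rule exI[of _ "(X T)(i := c)"]) (use that X c in \<open>auto simp: bad_def\<close>)
  qed
  then obtain x where x: "\<forall>j. j \<notin> S \<longrightarrow> x j = (y(i := c)) j" "\<forall>T\<in>Ts. f T x \<noteq> 0" by blast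
  have "x j = y j" if "j \<notin> insert i S" for j using x(1) that by auto
  with x(2) show ?case by blast
qed

text \<open>Laplace expansion along row i: its cofactors omit that row, so the determinant is affine
  in the entry. Two zeros at different entry values force the slope, a cofactor, to vanish.\<close>

lemma det_entry_affine:
  fixes Q :: "'c \<Rightarrow> 'a::idom mat"
  assumes Q: "\<And>c. Q c \<in> carrier_mat N N" and ij: "i < N" "j < N"
    and other: "\<And>c c' i' j'. i' < N \<Longrightarrow> j' < N \<Longrightarrow> (i', j') \<noteq> (i, j) \<Longrightarrow>
      Q c $$ (i', j') = Q c' $$ (i', j')"
    and neq: "Q c1 $$ (i, j) \<noteq> Q c2 $$ (i, j)"
    and zero: "det (Q c1) = 0" "det (Q c2) = 0"
  shows "det (Q c) = 0"
proof -
  have cof: "cofactor (Q c) i j' = cofactor (Q c1) i j'" if "j' < N" for c j'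
  proof -
    have "mat_delete (Q c) i j' = mat_delete (Q c1) i j'"
      using Q[of c] Q[of c1] that ij
      by (intro eq_matI) (auto simp: mat_delete_def intro!: other)
    then show ?thesis by (simp add: cofactor_def)
  qed
  define r where "r = (\<Sum>j'\<in>{..<N} - {j}. Q c1 $$ (i, j') * cofactor (Q c1) i j')"
  have exp: "det (Q c) = Q c $$ (i, j) * cofactor (Q c1) i j + r" for c
  proof -
    have "det (Q c) = (\<Sum>j'<N. Q c $$ (i, j') * cofactor (Q c1) i j')"
      unfolding laplace_expansion_row[OF Q ij(1)] by (intro sum.cong) (auto simp: cof[of _ c])
    also have "\<dots> = Q c $$ (i, j) * cofactor (Q c1) i j +
        (\<Sum>j'\<in>{..<N} - {j}. Q c $$ (i, j') * cofactor (Q c1) i j')"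
      using ij by (subst sum.remove[of _ j]) auto
    also have "(\<Sum>j'\<in>{..<N} - {j}. Q c $$ (i, j') * cofactor (Q c1) i j') = r"
      unfolding r_def using ij by (intro sum.cong refl arg_cong2[where f="(*)"] other) auto
    finally show ?thesis .
  qed
  have "(Q c1 $$ (i, j) - Q c2 $$ (i, j)) * cofactor (Q c1) i j = det (Q c1) - det (Q c2)"
    by (simp add: exp[of c1] exp[of c2] algebra_simps)
  then have "cofactor (Q c1) i j = 0" using zero neq by simp
  then show ?thesis using exp[of c] exp[of c1] zero by simp
qed

text \<open>Block elimination: \<open>?L\<close> has determinant 1 and \<open>?U\<close> carries the
  Schur complement A Y B. The bordered matrix itself contains no inverse.\<close>

lemma det_bordered:
  fixes X B A Y :: "'a::idom mat"
  assumes X: "X \<in> carrier_mat m m" "Y \<in> carrier_mat m m" "Y * X = 1\<^sub>m m" "X * Y = 1\<^sub>m m"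
    and B: "B \<in> carrier_mat m n" and A: "A \<in> carrier_mat n m"
  shows "det (four_block_mat X B (- A) (0\<^sub>m n n)) = det X * det (A * (Y * B))"
proof -
  have YB: "Y * B \<in> carrier_mat m n" and AYB: "A * (Y * B) \<in> carrier_mat n n"
    and AY: "A * Y \<in> carrier_mat n m" using X B A by auto
  let ?L = "four_block_mat (1\<^sub>m m) (0\<^sub>m m n) (- (A * Y)) (1\<^sub>m n)"
  let ?U = "four_block_mat X B (0\<^sub>m n m) (A * (Y * B))"
  have "?L * ?U = four_block_mat X B (- A) (0\<^sub>m n n)"
  proof (subst mult_four_block_mat[of _ m m _ n _ n _ _ m _ n])
    have 1: "- (A * Y) * X = - A"
      using A X AY by (simp add: assoc_mult_mat[OF A X(2) X(1)])
    have 2: "- (A * Y) * B = - (A * (Y * B))"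
      using A X AY B by (simp add: assoc_mult_mat[OF A X(2) B])
    have 3: "- A + 1\<^sub>m n * 0\<^sub>m n m = - A" "1\<^sub>m m * X + 0\<^sub>m m n * 0\<^sub>m n m = X"
      "1\<^sub>m m * B + 0\<^sub>m m n * (A * (Y * B)) = B"
      "- (A * (Y * B)) + 1\<^sub>m n * (A * (Y * B)) = 0\<^sub>m n n"
      using A X B AYB by auto
    show "four_block_mat (1\<^sub>m m * X + 0\<^sub>m m n * 0\<^sub>m n m) (1\<^sub>m m * B + 0\<^sub>m m n * (A * (Y * B)))
        (- (A * Y) * X + 1\<^sub>m n * 0\<^sub>m n m) (- (A * Y) * B + 1\<^sub>m n * (A * (Y * B))) =
        four_block_mat X B (- A) (0\<^sub>m n n)"
      unfolding 1 2 3 ..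
  qed (use X AY B AYB in auto)
  moreover have "det (?L * ?U) = det ?L * det ?U"
    by (rule det_mult[of _ "m + n"]) (use X AY B AYB in auto)
  moreover have "det ?L = 1"
    using AY by (subst det_four_block_mat_upper_right_zero[of _ m _ n]) auto
  moreover have "det ?U = det X * det (A * (Y * B))"
    using X B AYB by (subst det_four_block_mat_lower_left_zero[of _ m _ n]) auto
  ultimately show ?thesis by simp
qed


text \<open>Links determinants to the rank over rational functions in \<open>network_code\<close>;
  the embedding is an injective ring homomorphism.\<close>

lemma rank_eq_if_det_nonzero:
  fixes M :: "'f::field poly mat"
  assumes "M \<in> carrier_mat n n" "det M \<noteq> 0"
  shows "vec_space.rank n (map_mat to_fract M) = n"
proof -
  interpret to_fract: comm_ring_hom "to_fract :: 'f poly \<Rightarrow> _"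
    by unfold_locales auto
  have "det (map_mat to_fract M) \<noteq> 0" using assms(2) by simp
  then show ?thesis using vec_space.low_rank_det_zero[of "map_mat to_fract M" n] assms(1) by simp
qed

section \<open>Existence of multicast network codes\<close>

lemma (in pre_digraph) cas_nth_Suc:
  "cas u p v \<Longrightarrow> Suc l < length p \<Longrightarrow> head G (p ! l) = tail G (p ! Suc l)"
proof (induction p arbitrary: u l)
  case (Cons e p)
  then show ?case by (cases l; cases p) auto
qed simp

context multicast_network
begin

lemma strictly_upper_transfer_matrix:
  assumes "\<forall>i<length es. \<forall>j<length es. head G (es ! i) \<noteq> tail G (es ! j) \<longrightarrow> K $$ (i, j) = 0"
    and "i < length es" "j < length es" "K $$ (i, j) \<noteq> 0"
  shows "i < j"
  using assms ancestral by blast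

text \<open>A maximum family is cut down to n paths. An empty path would mean \<open>s = T\<close>,
  and then no nonempty simple path joins them; for \<open>2 \<le> n\<close> this contradicts the
  existence of a second path.\<close>

lemma ex_edge_disjoint_paths:
  assumes "T \<in> Ts" "2 \<le> n" "n \<le> max_edge_disjoint_paths G s T"
  obtains ps where "\<And>i. i < n \<Longrightarrow> apath s (ps i) T" "\<And>i. i < n \<Longrightarrow> ps i \<noteq> []"
    "\<And>i i'. i < n \<Longrightarrow> i' < n \<Longrightarrow> i \<noteq> i' \<Longrightarrow> set (ps i) \<inter> set (ps i') = {}"
proof -
  let ?\<P> = "{P. (\<forall>\<pi>\<in>P. apath s \<pi> T) \<and> pairwise (\<lambda>\<pi> \<pi>'. set \<pi> \<inter> set \<pi>' = {}) P}"
  have "?\<P> \<subseteq> Pow {p. apath s p T}" by auto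
  then have fin: "finite ?\<P>" using apaths_finite finite_subset by blast
  have eq: "{card P |P. (\<forall>\<pi>\<in>P. apath s \<pi> T) \<and> pairwise (\<lambda>\<pi> \<pi>'. set \<pi> \<inter> set \<pi>' = {}) P} =
      card ` ?\<P>" by auto
  have "{} \<in> ?\<P>" by simp
  then have "max_edge_disjoint_paths G s T \<in> card ` ?\<P>"
    unfolding max_edge_disjoint_paths_def eq using fin by (intro Max_in) auto
  then obtain P where P: "P \<in> ?\<P>" "n \<le> card P" using assms(3) by auto
  then obtain Q where Q: "Q \<subseteq> P" "card Q = n" "finite Q"
    using obtain_subset_with_card_n by metis
  then obtain ps where ps: "bij_betw ps {..<n} Q"
    using ex_bij_betw_nat_finite[of Q] by (metis lessThan_atLeast0)
  have path: "apath s (ps i) T" if "i < n" for i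
    using bij_betwE[OF ps] that P(1) Q(1) by auto
  have neq: "ps i \<noteq> ps i'" if "i < n" "i' < n" "i \<noteq> i'" for i i'
    using bij_betw_imp_inj_on[OF ps] that by (auto dest: inj_onD)
  have "ps i \<noteq> []" if i: "i < n" for i
  proof
    assume nil: "ps i = []"
    define i' where "i' = (if i = 0 then 1 else 0 :: nat)"
    have i': "i' < n" "i' \<noteq> i" using assms(2) by (auto simp: i'_def)
    have "ps i' \<noteq> []" using neq[OF i' (1) i i'(2)] nil by simp
    then have "s \<noteq> T" using apath_nonempty_ends[OF path[OF i'(1)]] by simp
    then show False using path[OF i] nil by (simp add: apath_Nil_iff)
  qed
  moreover have "set (ps i) \<inter> set (ps i') = {}" if i: "i < n" "i' < n" "i \<noteq> i'" for i i'
  proof -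
    have "ps i \<in> P" "ps i' \<in> P" using bij_betwE[OF ps] Q(1) i by auto
    moreover have "pairwise (\<lambda>\<pi> \<pi>'. set \<pi> \<inter> set \<pi>' = {}) P" using P(1) by simp
    ultimately show ?thesis using neq[OF i] unfolding pairwise_def by simp
  qed
  ultimately show thesis using that[of ps] path by simp
qed

text \<open>The conditions on a network code for one sink, with full rank as a nonzero determinant;
  \<open>A\<close> and \<open>K\<close> may still differ from sink to sink.\<close>

definition sink_code :: "nat \<Rightarrow> 'v \<Rightarrow> 'f::field mat \<Rightarrow> 'f mat \<Rightarrow> 'f mat \<Rightarrow> bool" where
  "sink_code n T A K B \<longleftrightarrow>
     A \<in> carrier_mat n (length es) \<and>
     (\<forall>i<n. \<forall>j<length es. es ! j \<notin> out_arcs G s \<longrightarrow> A $$ (i, j) = 0) \<and>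
     K \<in> carrier_mat (length es) (length es) \<and>
     (\<forall>i<length es. \<forall>j<length es. head G (es ! i) \<noteq> tail G (es ! j) \<longrightarrow> K $$ (i, j) = 0) \<and>
     B \<in> carrier_mat (length es) n \<and>
     (\<forall>i<length es. \<forall>j<n. es ! i \<notin> in_arcs G T \<longrightarrow> B $$ (i, j) = 0) \<and>
     det (MT_mat A K B) \<noteq> 0"

text \<open>\<open>A\<close> puts symbol i on the first arc of path i, \<open>K\<close> forwards it
  along the path, and \<open>B\<close> reads it off the last arc. The transfer matrix becomes
  diagonal with powers of z.\<close>

lemma routing_code:
  fixes ps :: "nat \<Rightarrow> 'e list"
  assumes path: "\<And>i. i < n \<Longrightarrow> apath s (ps i) T" and ne: "\<And>i. i < n \<Longrightarrow> ps i \<noteq> []"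
    and disj: "\<And>i i'. i < n \<Longrightarrow> i' < n \<Longrightarrow> i \<noteq> i' \<Longrightarrow> set (ps i) \<inter> set (ps i') = {}"
  shows "\<exists>A K B :: 'f::field mat. sink_code n T A K B"
proof -
  define m where "m = length es"
  have cas: "cas s (ps i) T" and arcs: "set (ps i) \<subseteq> arcs G" if "i < n" for i
    using path[OF that] by (auto simp: apath_def awalk_def)
  have dist: "distinct (ps i)" if "i < n" for i
    using path[OF that] ne[OF that] by (auto simp: apath_def awalk_verts_conv distinct_map)
  have first: "ps i ! 0 \<in> out_arcs G s" if "i < n" for i
    using cas[OF that] arcs[OF that] ne[OF that] by (cases "ps i") auto
  have last: "last (ps i) \<in> in_arcs G T" if "i < n" for i
  proof -
    have "T = head G (last (ps i))"
      using awlast_if_cas[OF cas[OF that]] ne[OF that] by (simp add: awalk_verts_conv)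
    then show ?thesis using arcs[OF that] ne[OF that] last_in_set[of "ps i"] by auto
  qed
  have pos_inj: "l = l'"
    if "i < n" "l < length (ps i)" "l' < length (ps i)" "ps i ! l = ps i ! l'" for i l l'
    using dist[OF that(1)] that nth_eq_iff_index_eq by blast
  have owner: "i = i'" if "i < n" "i' < n" "e \<in> set (ps i)" "e \<in> set (ps i')" for i i' e
    using disj that by blast
  have es_inj: "j = j'" if "j < m" "j' < m" "es ! j = es ! j'" for j j'
    using that edge_list(2) nth_eq_iff_index_eq m_def by blast
  have es_index: "\<exists>j<m. es ! j = e" if "i < n" "e \<in> set (ps i)" for i e
    using arcs[OF that(1)] that(2) edge_list(1) by (metis in_set_conv_nth m_def subsetD)

  define A :: "'f mat" where "A = mat n m (\<lambda>(i, j). if es ! j = ps i ! 0 then 1 else 0)"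
  define K :: "'f mat" where "K = mat m m (\<lambda>(j, j').
    if \<exists>i<n. \<exists>l. Suc l < length (ps i) \<and> es ! j = ps i ! l \<and> es ! j' = ps i ! Suc l then 1 else 0)"
  define B :: "'f mat" where "B = mat m n (\<lambda>(j, i). if es ! j = last (ps i) then 1 else 0)"
  \<comment> \<open>\<open>R\<close> is the product of \<open>A\<close> and \<open>F_mat K\<close>: symbol \<open>i\<close> crosses the \<open>l\<close>-th arc of its path after delay \<open>l\<close>.\<close>
  define R :: "'f poly mat" where "R = mat n m (\<lambda>(i, j).
    \<Sum>l<length (ps i). if es ! j = ps i ! l then monom 1 l else 0)"
  have car: "A \<in> carrier_mat n m" "K \<in> carrier_mat m m" "B \<in> carrier_mat m n" "R \<in> carrier_mat n m"
    by (simp_all add: A_def K_def B_def R_def)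
  have R_on: "R $$ (i, j) = monom 1 l" if "i < n" "j < m" "l < length (ps i)" "es ! j = ps i ! l" for i j l
  proof -
    have "R $$ (i, j) = (\<Sum>l'<length (ps i). if es ! j = ps i ! l' then monom 1 l' else 0)"
      using that by (simp add: R_def)
    also have "\<dots> = (\<Sum>l'<length (ps i). if l' = l then monom 1 l else 0)"
      by (intro sum.cong refl) (use that(3,4) pos_inj[OF that(1)] in auto)
    finally have "R $$ (i, j) = (\<Sum>l'<length (ps i). if l' = l then monom 1 l else 0)" .
    then show ?thesis using that by simp
  qed
  have R_off: "R $$ (i, j) = 0" if "i < n" "j < m" "es ! j \<notin> set (ps i)" for i j
    using that unfolding R_def by (auto intro!: sum.neutral)
  have K_supp: "\<forall>i<m. \<forall>j<m. head G (es ! i) \<noteq> tail G (es ! j) \<longrightarrow> K $$ (i, j) = 0"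
    using cas_nth_Suc[OF cas] by (auto simp: K_def)
  define X where "X = 1\<^sub>m m - [:0, 1:] \<cdot>\<^sub>m const_mat K"
  have X: "X \<in> carrier_mat m m" using car by (simp add: X_def minus_carrier_mat)
  have strict: "i < j" if "i < m" "j < m" "K $$ (i, j) \<noteq> 0" for i j
    using strictly_upper_transfer_matrix[of K i j] K_supp that by (simp add: m_def)
  have F: "F_mat K \<in> carrier_mat m m" "X * F_mat K = 1\<^sub>m m"
    unfolding X_def by (rule F_mat_correct[OF car(2)], rule strict, assumption+)+
  \<comment> \<open>Checking this identity avoids computing \<open>F_mat K\<close>. \<open>S\<close>
    below is what reaches arc \<open>j'\<close> from preceding arcs after one unit of delay.\<close>
  have RX: "R * X = const_mat A"
  proof (rule eq_matI)
    fix i j' assume "i < dim_row (const_mat A)" "j' < dim_col (const_mat A)"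
    then have ij: "i < n" "j' < m" using car by auto
    define S where "S = (\<Sum>j<m. R $$ (i, j) * [:0, K $$ (j, j'):])"
    have "(R * X) $$ (i, j') = (\<Sum>j<m. R $$ (i, j) * X $$ (j, j'))"
      using car X ij by (simp add: scalar_prod_def lessThan_atLeast0)
    also have "\<dots> = (\<Sum>j<m. (if j = j' then R $$ (i, j) else 0) - R $$ (i, j) * [:0, K $$ (j, j'):])"
      using ij car by (intro sum.cong) (auto simp: X_def right_diff_distrib)
    also have "\<dots> = R $$ (i, j') - S" using ij by (simp add: sum_subtractf S_def)
    finally have RX_eq: "(R * X) $$ (i, j') = R $$ (i, j') - S" .
    \<comment> \<open>Edge-disjointness enters: an arc carrying symbol i lies on no other path, so
      \<open>K\<close> forwards it only along \<open>ps i\<close>.\<close>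
    have term_nz: "\<exists>l. Suc l < length (ps i) \<and> es ! j = ps i ! l \<and> es ! j' = ps i ! Suc l"
      if "j < m" "R $$ (i, j) * [:0, K $$ (j, j'):] \<noteq> 0" for j
    proof -
      have on: "es ! j \<in> set (ps i)" using R_off[OF ij(1) that(1)] that(2) by auto
      have "K $$ (j, j') \<noteq> 0" using that(2) by auto
      then obtain i' l where l: "i' < n" "Suc l < length (ps i')" "es ! j = ps i' ! l" "es ! j' = ps i' ! Suc l"
        using \<open>j < m\<close> ij(2) by (auto simp: K_def split: if_splits)
      then have "i' = i" using owner[of i' i "es ! j"] ij(1) on by simp
      with l show ?thesis by blast
    qed
    have "R $$ (i, j') - S = const_mat A $$ (i, j')"
    proof (cases "es ! j' \<in> set (ps i)")
      case False
      have "S = 0" unfolding S_def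
      proof (rule sum.neutral, rule ballI, rule ccontr)
        fix j assume "j \<in> {..<m}" "R $$ (i, j) * [:0, K $$ (j, j'):] \<noteq> 0"
        then show False using term_nz[of j] False by auto
      qed
      moreover have "A $$ (i, j') = 0" using False ij ne[OF ij(1)] by (auto simp: A_def)
      ultimately show ?thesis using R_off[OF ij False] ij car by simp
    next
      case True
      then obtain l where l: "l < length (ps i)" "es ! j' = ps i ! l" by (auto simp: in_set_conv_nth)
      have R_l: "R $$ (i, j') = monom 1 l" using R_on[OF ij l] .
      show ?thesis
      proof (cases l)
        case 0
        have "S = 0" unfolding S_def
        proof (rule sum.neutral, rule ballI, rule ccontr)
          fix j assume "j \<in> {..<m}" "R $$ (i, j) * [:0, K $$ (j, j'):] \<noteq> 0"
          then obtain l' where "Suc l' < length (ps i)" "es ! j' = ps i ! Suc l'" using term_nz[of j] by auto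
          then show False using pos_inj[OF ij(1) l(1), of "Suc l'"] l 0 by simp
        qed
        moreover have "A $$ (i, j') = 1" using l 0 ij by (simp add: A_def)
        ultimately show ?thesis using R_l 0 ij car by (simp add: one_pCons[symmetric])
      next
        case (Suc l0)
        \<comment> \<open>Beyond the first arc, the only contribution comes from the preceding arc
          of the path, with one more factor z.\<close>
        obtain j where j: "j < m" "es ! j = ps i ! l0"
          using es_index[OF ij(1), of "ps i ! l0"] l Suc by auto
        have "S = R $$ (i, j) * [:0, K $$ (j, j'):] +
            (\<Sum>j\<in>{..<m} - {j}. R $$ (i, j) * [:0, K $$ (j, j'):])"
          unfolding S_def using j(1) by (intro sum.remove) auto
        also have "(\<Sum>j\<in>{..<m} - {j}. R $$ (i, j) * [:0, K $$ (j, j'):]) = 0"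
        proof (rule sum.neutral, rule ballI, rule ccontr)
          fix j1 assume j1: "j1 \<in> {..<m} - {j}" "R $$ (i, j1) * [:0, K $$ (j1, j'):] \<noteq> 0"
          then obtain l' where l': "Suc l' < length (ps i)" "es ! j1 = ps i ! l'" "es ! j' = ps i ! Suc l'"
            using term_nz[of j1] by auto
          then have "l' = l0" using pos_inj[OF ij(1) l(1), of "Suc l'"] l Suc by simp
          then show False using es_inj[of j1 j] j1(1) j l' by simp
        qed
        also have "R $$ (i, j) = monom 1 l0" using R_on[OF ij(1) j(1), of l0] j l Suc by simp
        also have "K $$ (j, j') = 1" using j l Suc ij by (auto simp: K_def)
        finally have "S = monom 1 l" using Suc by (simp add: monom_Suc)
        moreover have "A $$ (i, j') = 0"
          using pos_inj[OF ij(1) l(1), of 0] l Suc ij ne[OF ij(1)] by (auto simp: A_def)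
        ultimately show ?thesis using R_l ij car by simp
      qed
    qed
    then show "(R * X) $$ (i, j') = const_mat A $$ (i, j')" using RX_eq by simp
  qed (use car X in auto)
  have "MT_mat A K B = R * X * (F_mat K * const_mat B)" by (simp add: MT_mat_def FT_mat_def RX)
  also have "\<dots> = R * (X * (F_mat K * const_mat B))"
    using car X F(1) by (intro assoc_mult_mat[of _ n m _ m _ n]) auto
  also have "X * (F_mat K * const_mat B) = X * F_mat K * const_mat B"
    using car X F(1) by (intro assoc_mult_mat[symmetric, of _ m m _ m _ n]) auto
  also have "\<dots> = const_mat B" unfolding F(2) using car by simp
  finally have M: "MT_mat A K B = R * const_mat B" .
  \<comment> \<open>Column i' of \<open>B\<close> selects the last arc of path i', which no other
    path uses. The first arc carries delay 0, hence the length minus 1.\<close>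
  have M_entry: "MT_mat A K B $$ (i, i') = (if i = i' then monom 1 (length (ps i) - 1) else 0)"
    if i: "i < n" "i' < n" for i i'
  proof -
    obtain j where j: "j < m" "es ! j = last (ps i')"
      using es_index[OF i(2), of "last (ps i')"] ne[OF i(2)] by auto
    have "MT_mat A K B $$ (i, i') = (\<Sum>j1<m. R $$ (i, j1) * [:B $$ (j1, i'):])"
      unfolding M using car i by (simp add: scalar_prod_def lessThan_atLeast0)
    also have "\<dots> = (\<Sum>j1<m. if j1 = j then R $$ (i, j) else 0)"
    proof (intro sum.cong refl)
      fix j1 assume j1: "j1 \<in> {..<m}"
      then have "B $$ (j1, i') = (if es ! j1 = es ! j then 1 else 0)" using i(2) j(2) by (simp add: B_def)
      moreover have "es ! j1 = es ! j \<longleftrightarrow> j1 = j" using es_inj[of j1 j] j1 j(1) by auto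
      ultimately show "R $$ (i, j1) * [:B $$ (j1, i'):] = (if j1 = j then R $$ (i, j) else 0)" by simp
    qed
    also have "\<dots> = R $$ (i, j)" using j by simp
    also have "\<dots> = (if i = i' then monom 1 (length (ps i) - 1) else 0)"
    proof (cases "i = i'")
      case True
      then show ?thesis using R_on[OF i(1) j(1), of "length (ps i) - 1"] j ne[OF i(1)]
        by (simp add: last_conv_nth)
    next
      case False
      then have "es ! j \<notin> set (ps i)" using owner[OF i, of "es ! j"] j ne[OF i(2)] by auto
      then show ?thesis using R_off[OF i(1) j(1)] False by simp
    qed
    finally show ?thesis .
  qed
  have MT: "MT_mat A K B \<in> carrier_mat n n" unfolding M using car by simp
  have "det (MT_mat A K B) = prod_list (diag_mat (MT_mat A K B))"
    using MT M_entry by (intro det_lower_triangular[of n]) auto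
  also have "\<dots> \<noteq> 0" using MT M_entry by (auto simp: prod_list_zero_iff diag_mat_def)
  finally have "det (MT_mat A K B) \<noteq> 0" .
  moreover have "\<forall>i<n. \<forall>j<m. es ! j \<notin> out_arcs G s \<longrightarrow> A $$ (i, j) = 0"
    using first by (auto simp: A_def)
  moreover have "\<forall>i<m. \<forall>j<n. es ! i \<notin> in_arcs G T \<longrightarrow> B $$ (i, j) = 0"
    using last by (auto simp: B_def)
  ultimately have "sink_code n T A K B"
    unfolding sink_code_def m_def[symmetric] using car K_supp by simp
  then show ?thesis by blast
qed

section \<open>Bordered matrices and a common code for all sinks\<close>

definition bordered_mat :: "nat \<Rightarrow> 'f::field mat \<Rightarrow> (nat \<times> nat \<Rightarrow> 'f) \<Rightarrow> 'f poly mat" where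
  "bordered_mat n B x = (let m = length es in
     four_block_mat (1\<^sub>m m - [:0, 1:] \<cdot>\<^sub>m const_mat (mat m m x)) (const_mat B)
       (- const_mat (mat n m (\<lambda>(i, j). x (m + i, j)))) (0\<^sub>m n n))"

lemma bordered_mat_carrier:
  "B \<in> carrier_mat (length es) n \<Longrightarrow>
    bordered_mat n B x \<in> carrier_mat (length es + n) (length es + n)"
  by (auto simp: bordered_mat_def Let_def)

lemma bordered_mat_index:
  assumes "B \<in> carrier_mat (length es) n" "i < length es + n" "j < length es + n"
  shows "bordered_mat n B x $$ (i, j) =
    (if j < length es
     then if i < length es then (if i = j then 1 else 0) - [:0, x (i, j):] else - [:x (i, j):]
     else if i < length es then [:B $$ (i, j - length es):] else 0)"
  using assms by (auto simp: bordered_mat_def Let_def)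

text \<open>
  A point \<open>x\<close> packs both matrices: rows below \<open>length es\<close> are the rows of \<open>K\<close>, and row
  \<open>length es + i\<close> is row \<open>i\<close> of \<open>A\<close>.
\<close>

definition coding_positions :: "nat \<Rightarrow> (nat \<times> nat) set" where
  "coding_positions n =
     {(i, j). j < length es \<and>
        (if i < length es then head G (es ! i) = tail G (es ! j)
         else i < length es + n \<and> es ! j \<in> out_arcs G s)}"

lemma finite_coding_positions: "finite (coding_positions n)"
proof (rule finite_subset)
  show "coding_positions n \<subseteq> {..<length es + n} \<times> {..<length es}"
    by (auto simp: coding_positions_def split: if_splits)
qed simp

text \<open>The packing makes the index of a variable also its position in the bordered matrix, so
  changing \<open>x\<close> at \<open>p\<close> alters exactly one entry.\<close>

lemma det_bordered_mat_affine:
  fixes x :: "nat \<times> nat \<Rightarrow> 'f::field"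
  assumes B: "B \<in> carrier_mat (length es) n" and p: "p \<in> coding_positions n" and "c1 \<noteq> c2"
    and "det (bordered_mat n B (x(p := c1))) = 0" "det (bordered_mat n B (x(p := c2))) = 0"
  shows "det (bordered_mat n B (x(p := c))) = 0"
proof -
  obtain i j where ij: "p = (i, j)" "i < length es + n" "j < length es"
    using p by (auto simp: coding_positions_def split: if_splits)
  show ?thesis
  proof (rule det_entry_affine[where Q = "\<lambda>c. bordered_mat n B (x(p := c))" and i = i and j = j])
    show "bordered_mat n B (x(p := c)) \<in> carrier_mat (length es + n) (length es + n)" for c
      by (rule bordered_mat_carrier[OF B])
    show "i < length es + n" "j < length es + n" using ij by simp_all
    show "bordered_mat n B (x(p := c)) $$ (i', j') = bordered_mat n B (x(p := c')) $$ (i', j')"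
      if "i' < length es + n" "j' < length es + n" "(i', j') \<noteq> (i, j)" for c c' i' j'
      using that ij(1) by (auto simp: bordered_mat_index[OF B])
    show "bordered_mat n B (x(p := c1)) $$ (i, j) \<noteq> bordered_mat n B (x(p := c2)) $$ (i, j)"
      using ij \<open>c1 \<noteq> c2\<close> by (simp add: bordered_mat_index[OF B])
  qed (use assms in auto)
qed

text \<open>The support of \<open>x\<close> makes \<open>K\<close> strictly upper triangular, so I -
  zK is invertible with inverse \<open>F_mat K\<close>. Its determinant is a nonzero factor next to
  that of the Schur complement, the transfer matrix.\<close>

lemma det_bordered_mat_eq_0_iff:
  fixes x :: "nat \<times> nat \<Rightarrow> 'f::field"
  assumes B: "B \<in> carrier_mat (length es) n" and x: "\<And>p. p \<notin> coding_positions n \<Longrightarrow> x p = 0"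
  defines "m \<equiv> length es"
  shows "det (bordered_mat n B x) = 0 \<longleftrightarrow>
    det (MT_mat (mat n m (\<lambda>(i, j). x (m + i, j))) (mat m m x) B) = 0"
proof -
  define K where "K = mat m m x"
  define A where "A = mat n m (\<lambda>(i, j). x (m + i, j))"
  define X where "X = 1\<^sub>m m - [:0, 1:] \<cdot>\<^sub>m const_mat K"
  have K: "K \<in> carrier_mat m m" and A: "A \<in> carrier_mat n m" by (simp_all add: K_def A_def)
  have X: "X \<in> carrier_mat m m" using K by (simp add: X_def minus_carrier_mat)
  have strict: "i < j" if "i < m" "j < m" "K $$ (i, j) \<noteq> 0" for i j
    using x[of "(i, j)"] that ancestral by (auto simp: K_def coding_positions_def m_def)
  have F: "F_mat K \<in> carrier_mat m m" "X * F_mat K = 1\<^sub>m m" "F_mat K * X = 1\<^sub>m m"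
    unfolding X_def by (rule F_mat_correct[OF K], rule strict, assumption+)+
  have "det X * det (F_mat K) = 1" using det_mult[OF X F(1)] F(2) by simp
  then have "det X \<noteq> 0" by auto
  moreover have "det (bordered_mat n B x) = det X * det (const_mat A * (F_mat K * const_mat B))"
    unfolding bordered_mat_def Let_def m_def[symmetric] K_def[symmetric] A_def[symmetric]
      X_def[symmetric]
    by (rule det_bordered[OF X F(1,3,2)]) (use A B m_def in auto)
  ultimately show ?thesis
    unfolding K_def[symmetric] A_def[symmetric] MT_mat_def FT_mat_def by simp
qed

text \<open>Routing gives every sink its own \<open>A\<close>, \<open>K\<close> and
  \<open>B T\<close>. The \<open>B T\<close> are kept, and one common pair \<open>A\<close>,
  \<open>K\<close> is selected entry by entry.\<close>

theorem ex_network_code: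
  assumes "2 \<le> n" "n = multicast_min_cut G s Ts" "card Ts < CARD('f::{field,finite})"
  shows "\<exists>(A :: 'f mat) K B. network_code G s Ts es n A K B"
proof -
  define m where "m = length es"
  have fin: "finite Ts" using sinks(1) finite_subset finite_verts by blast
  have "\<exists>A K B :: 'f mat. sink_code n T A K B" if T: "T \<in> Ts" for T
  proof -
    have "n \<le> max_edge_disjoint_paths G s T"
      using assms(2) fin T unfolding multicast_min_cut_def by simp
    from ex_edge_disjoint_paths[OF T assms(1) this] obtain ps where ps:
      "\<And>i. i < n \<Longrightarrow> apath s (ps i) T" "\<And>i. i < n \<Longrightarrow> ps i \<noteq> []"
      "\<And>i i'. i < n \<Longrightarrow> i' < n \<Longrightarrow> i \<noteq> i' \<Longrightarrow> set (ps i) \<inter> set (ps i') = {}"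
      by metis
    show ?thesis by (rule routing_code[where ps=ps]) (fact ps)+
  qed
  then obtain A0 K0 and B :: "'v \<Rightarrow> 'f mat"
    where code: "\<And>T. T \<in> Ts \<Longrightarrow> sink_code n T (A0 T) (K0 T) (B T)"
    by metis
  have A0: "A0 T \<in> carrier_mat n m"
      "\<And>i j. i < n \<Longrightarrow> j < m \<Longrightarrow> es ! j \<notin> out_arcs G s \<Longrightarrow> A0 T $$ (i, j) = 0"
    and K0: "K0 T \<in> carrier_mat m m"
      "\<And>i j. i < m \<Longrightarrow> j < m \<Longrightarrow> head G (es ! i) \<noteq> tail G (es ! j) \<Longrightarrow> K0 T $$ (i, j) = 0"
    and B: "B T \<in> carrier_mat m n"
      "\<forall>i<m. \<forall>j<n. es ! i \<notin> in_arcs G T \<longrightarrow> B T $$ (i, j) = 0"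
    and det0: "det (MT_mat (A0 T) (K0 T) (B T)) \<noteq> 0" if T: "T \<in> Ts" for T
    using code[OF T] unfolding sink_code_def m_def[symmetric] by simp_all
  define S where "S = coding_positions n"
  have "\<exists>x :: nat \<times> nat \<Rightarrow> 'f. (\<forall>p. p \<notin> S \<longrightarrow> x p = 0) \<and> (\<forall>T\<in>Ts. det (bordered_mat n (B T) x) \<noteq> 0)"
  proof (rule affine_family_common_nonzero[where y = "\<lambda>_. 0"])
    show "finite S" unfolding S_def by (rule finite_coding_positions)
    show "\<exists>x :: nat \<times> nat \<Rightarrow> 'f. (\<forall>p. p \<notin> S \<longrightarrow> x p = 0) \<and> det (bordered_mat n (B T) x) \<noteq> 0"
      if T: "T \<in> Ts" for T
    proof (intro exI conjI)
      \<comment> \<open>The routing matrices of \<open>T\<close> as a point; by their support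
        conditions, restricting to \<open>S\<close> loses nothing.\<close>
      let ?x = "\<lambda>(i, j). if (i, j) \<in> S then if i < m then K0 T $$ (i, j) else A0 T $$ (i - m, j) else 0"
      have "mat m m ?x = K0 T"
        using K0(1)[OF T] by (intro eq_matI) (auto simp: S_def coding_positions_def m_def K0(2)[OF T])
      moreover have "mat n m (\<lambda>(i, j). ?x (m + i, j)) = A0 T"
        using A0(1)[OF T] A0(2)[OF T] by (intro eq_matI) (auto simp: S_def coding_positions_def m_def)
      ultimately show "det (bordered_mat n (B T) ?x) \<noteq> 0"
        using det_bordered_mat_eq_0_iff[of "B T" n ?x] B(1)[OF T] det0[OF T]
        by (auto simp: m_def S_def)
    qed auto
    show "det (bordered_mat n (B T) (x(p := c))) = 0"
      if "T \<in> Ts" "p \<in> S" "c1 \<noteq> c2" "det (bordered_mat n (B T) (x(p := c1))) = 0"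
        "det (bordered_mat n (B T) (x(p := c2))) = 0" for T x p c c1 c2
      using det_bordered_mat_affine[of "B T" n p c1 c2 x c] B(1)[of T] that by (simp add: S_def m_def)
  qed (use fin assms(3) in simp_all)
  then obtain x :: "nat \<times> nat \<Rightarrow> 'f" where x: "\<And>p. p \<notin> S \<Longrightarrow> x p = 0"
    "\<And>T. T \<in> Ts \<Longrightarrow> det (bordered_mat n (B T) x) \<noteq> 0" by blast
  define A where "A = mat n m (\<lambda>(i, j). x (m + i, j))"
  define K where "K = mat m m x"
  have car: "A \<in> carrier_mat n m" "K \<in> carrier_mat m m" by (simp_all add: A_def K_def)
  have K_supp: "\<forall>i<m. \<forall>j<m. head G (es ! i) \<noteq> tail G (es ! j) \<longrightarrow> K $$ (i, j) = 0"
    using x(1) by (auto simp: K_def S_def coding_positions_def m_def)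
  have "vec_space.rank n (map_mat to_fract (MT_mat A K (B T))) = n" if T: "T \<in> Ts" for T
  proof (rule rank_eq_if_det_nonzero)
    have "F_mat K \<in> carrier_mat m m"
      using strictly_upper_transfer_matrix[of K] K_supp
      by (intro F_mat_correct(1)[OF car(2)]) (auto simp: m_def)
    then show "MT_mat A K (B T) \<in> carrier_mat n n"
      using car B(1)[OF T] by (auto simp: MT_mat_def FT_mat_def)
    show "det (MT_mat A K (B T)) \<noteq> 0"
      using x(2)[OF T] det_bordered_mat_eq_0_iff[of "B T" n x] B(1)[OF T] x(1)
      by (simp add: A_def K_def m_def S_def)
  qed
  moreover have "\<forall>i<n. \<forall>j<m. es ! j \<notin> out_arcs G s \<longrightarrow> A $$ (i, j) = 0"
    using x(1) by (auto simp: A_def S_def coding_positions_def m_def)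
  ultimately have "network_code G s Ts es n A K B"
    unfolding network_code_def Let_def m_def[symmetric] using car K_supp B by blast
  then show ?thesis by blast
qed

end

theorem theorem2:
  fixes G :: "('v, 'e) pre_digraph" and s :: 'v and Ts :: "'v set" and es :: "'e list"
    and \<Phi> :: "'e set set" and n k :: nat
  assumes "multicast_network G s Ts es"
    and "n = multicast_min_cut G s Ts"
    and "\<Phi> \<subseteq> Pow (arcs G)"
    and "1 \<le> k" and "k < n"
  shows "(card Ts < CARD('f::{field,finite}) \<longrightarrow>
           (\<exists>(A :: 'f mat) K B. network_code G s Ts es n A K B)) \<and>
         (\<forall>(A :: 'f mat) K B p r.
           network_code G s Ts es n A K B \<and>
           (\<forall>T\<in>Ts. processing_function A K (B T) (p T)) \<and>
           r = max_processing_weight Ts p \<and>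
           n dvd (CARD('f) - 1) \<and>
           real CARD('f) >
             max (real (card Ts))
                 (2 * real r * (real n)\<^sup>2 * ((real n + 1) * (real (T_delay K) - 1) + 1) /
                    (real n - real k) + 2) \<longrightarrow>
           (\<exists>C :: 'f fps vec set. convolutional_code k n C \<and>
              d_free n C \<ge> enat (2 * t_s Ts es \<Phi> A K B p + 1)))"
proof (intro conjI impI allI)
  interpret multicast_network G s Ts es by fact
  assume "card Ts < CARD('f)"
  \<comment> \<open>\<open>1 \<le> k\<close> and \<open>k < n\<close> give \<open>2 \<le> n\<close>,
    which excludes empty paths.\<close>
  then show "\<exists>(A :: 'f mat) K B. network_code G s Ts es n A K B"
    using ex_network_code[of n, where 'f='f] assms(2,4,5) by simp
next
  fix A K :: "'f mat" and B p and r :: nat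
  \<comment> \<open>The number of ruler terms is fitted to the required distance 2 t_s + 1.\<close>
  show "\<exists>C :: 'f fps vec set. convolutional_code k n C \<and>
      d_free n C \<ge> enat (2 * t_s Ts es \<Phi> A K B p + 1)"
    by (rule ex_convolutional_code_d_free_ge[OF assms(5)])
qed

end
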